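(* Consider a spherically symmetric solution of the Einstein-scalar field system in double null coordinates, in the setting described in the context, defined on $\mathcal{D}(0,v_1)\cup([u_0,u_*]\times[v_1,v_2])$. Assume that Minkowskian data are prescribed along $v=v_1$, i.e. $m(u,v_1)=0$ for all $u\in[u_0,0]$, and that $\phi(u,v_1)=0$ for all $u\in[u_0,0]$. Suppose that $$\eta_0>\frac{9}{2}\,\delta_0 .$$ Then there exists a MOTS or a trapped surface in $[u_0,u_*]\times[v_1,v_2]$, i.e. $\partial_v r\le 0$ at some point of $[u_0,u_*]\times[v_1,v_2]$.
   Context: The Einstein-scalar field system is $R_{\mu\nu}-\frac12 R g_{\mu\nu}=8\pi T_{\mu\nu}$ with $T_{\mu\nu}=\partial_\mu\phi\partial_\nu\phi-\frac12 g_{\mu\nu}\partial^\sigma\phi\partial_\sigma\phi$, $\phi$ real. In spherical symmetry the metric is $g=-\Omega^2(u,v)\,du\,dv+r^2(u,v)(d\theta^2+\sin^2\theta\,d\varphi^2)$ with $\Omega>0$ and $\phi=\phi(u,v)$; each point $(u,v)$ represents a 2-sphere $S_{u,v}$. The system implies $$r\partial_v\partial_u r+\partial_v r\,\partial_u r=-\tfrac{\Omega^2}{4},\quad \partial_u(\Omega^{-2}\partial_u r)=-4\pi r\Omega^{-2}|\partial_u\phi|^2,$$ $$\partial_v(\Omega^{-2}\partial_v r)=-4\pi r\Omega^{-2}|\partial_v\phi|^2,\quad r\partial_u\partial_v\phi+\partial_u r\,\partial_v\phi+\partial_v r\,\partial_u\phi=0 .$$ Coordinates: $u_0<0<v_1<v_2$.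 $\Gamma$ is the center of symmetry, where $r=0$; $r>0$ away from $\Gamma$, and the solution is smooth with $m=0$ on $\Gamma$. $C=\{u=u_0,\ v\ge 0\}$ is the outgoing initial cone, which meets $\Gamma$ at $(u_0,0)$; $\underline{C}=\{v=v_1,\ u_0\le u\le 0\}$ is the incoming initial cone, which meets $\Gamma$ at $(0,v_1)$. $\mathcal{D}(0,v_1)$ is the region bounded by $C$, $\underline{C}$ and $\Gamma$. Normalization: $\Omega^2=1$ on $C\cup\underline{C}$, and $\partial_v r(u_0,0)=-\partial_u r(u_0,0)$. Hawking mass: $m=\frac r2(1+4\Omega^{-2}\partial_u r\,\partial_v r)$. Notation: $r_i(u)=r(u,v_i)$, $m_i(u)=m(u,v_i)$, $i=1,2$; $\delta_0=\frac{r_2(u_0)}{r_1(u_0)}-1$; $\eta_0=\frac{2(m_2(u_0)-m_1(u_0))}{r_2(u_0)}$. $u_*\in[u_0,0]$ denotes the value of $u$ (assumed to exist) with $r_2(u_* )=\frac{3\delta_0}{1+\delta_0}\,r_2(u_0)$. A point $(u,v)$ is a trapped surface if $\partial_u r(u,v)<0$ and $\partial_v r(u,v)<0$; it is a marginally outer trapped surface (MOTS) if $\partial_v r(u,v)=0$. *)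

theory Defs
  imports "HOL-Analysis.Analysis"
begin

text \<open>Functions of the double null coordinates \<open>(u, v)\<close> have type \<open>real \<times> real \<Rightarrow> real\<close>.\<close>

definition du :: "(real \<times> real \<Rightarrow> real) \<Rightarrow> real \<times> real \<Rightarrow> real" where
  "du f = (\<lambda>(u, v). deriv (\<lambda>s. f (s, v)) u)"

definition dv :: "(real \<times> real \<Rightarrow> real) \<Rightarrow> real \<times> real \<Rightarrow> real" where
  "dv f = (\<lambda>(u, v). deriv (\<lambda>s. f (u, s)) v)"

fun Ck_on :: "nat \<Rightarrow> (real \<times> real) set \<Rightarrow> (real \<times> real \<Rightarrow> real) \<Rightarrow> bool" where
  "Ck_on 0 U f \<longleftrightarrow> continuous_on U f"
| "Ck_on (Suc k) U f \<longleftrightarrow> f differentiable_on U \<and> Ck_on k U (du f) \<and> Ck_on k U (dv f)"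

text \<open>Smoothness on a closed region, up to and including its boundary: the function is smooth
  on an open neighbourhood of the region. Thus \<open>f\<close> stands for a smooth extension, and its
  two-sided partial derivatives are meaningful at boundary points. Nothing but smoothness is
  ever required outside the region.\<close>

definition smooth_up_to_boundary :: "(real \<times> real) set \<Rightarrow> (real \<times> real \<Rightarrow> real) \<Rightarrow> bool" where
  "smooth_up_to_boundary K f \<longleftrightarrow> (\<exists>U. open U \<and> K \<subseteq> U \<and> (\<forall>k. Ck_on k U f))"

text \<open>The Einstein-scalar field system
  \<open>R\<^sub>\<mu>\<^sub>\<nu> - R g\<^sub>\<mu>\<^sub>\<nu> / 2 = 8 \<pi> T\<^sub>\<mu>\<^sub>\<nu>\<close>,
  \<open>T\<^sub>\<mu>\<^sub>\<nu> = \<partial>\<^sub>\<mu>\<phi> \<partial>\<^sub>\<nu>\<phi> - g\<^sub>\<mu>\<^sub>\<nu> \<partial>\<^sup>\<sigma>\<phi> \<partial>\<^sub>\<sigma>\<phi> / 2\<close>,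
  for \<open>\<phi> = \<phi>(u, v)\<close> and the metric
  \<open>- \<Omega>\<^sup>2 du dv + r\<^sup>2 (d\<theta>\<^sup>2 + sin\<^sup>2 \<theta> d\<psi>\<^sup>2)\<close>, in its spherically symmetric form:
  the equation for the area radius, the two Raychaudhuri equations, and the wave equation.\<close>

definition einstein_scalar_at ::
  "(real \<times> real \<Rightarrow> real) \<Rightarrow> (real \<times> real \<Rightarrow> real) \<Rightarrow> (real \<times> real \<Rightarrow> real) \<Rightarrow> real \<times> real \<Rightarrow> bool"
where
  "einstein_scalar_at r \<Omega> \<phi> p \<longleftrightarrow>
     r p * dv (du r) p + dv r p * du r p = - (\<Omega> p)\<^sup>2 / 4 \<and>
     du (\<lambda>q. du r q / (\<Omega> q)\<^sup>2) p = - 4 * pi * r p / (\<Omega> p)\<^sup>2 * \<bar>du \<phi> p\<bar>\<^sup>2 \<and>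
     dv (\<lambda>q. dv r q / (\<Omega> q)\<^sup>2) p = - 4 * pi * r p / (\<Omega> p)\<^sup>2 * \<bar>dv \<phi> p\<bar>\<^sup>2 \<and>
     r p * du (dv \<phi>) p + du r p * dv \<phi> p + dv r p * du \<phi> p = 0"

definition hawking_mass ::
  "(real \<times> real \<Rightarrow> real) \<Rightarrow> (real \<times> real \<Rightarrow> real) \<Rightarrow> real \<times> real \<Rightarrow> real" where
  "hawking_mass r \<Omega> p = r p / 2 * (1 + 4 * du r p * dv r p / (\<Omega> p)\<^sup>2)"

definition trapped_surface :: "(real \<times> real \<Rightarrow> real) \<Rightarrow> real \<times> real \<Rightarrow> bool" where
  "trapped_surface r p \<longleftrightarrow> du r p < 0 \<and> dv r p < 0"

definition MOTS :: "(real \<times> real \<Rightarrow> real) \<Rightarrow> real \<times> real \<Rightarrow> bool" where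
  "MOTS r p \<longleftrightarrow> dv r p = 0"

text \<open>The center of symmetry is a timelike curve from \<open>(u\<^sub>0, 0)\<close>, on the outgoing initial cone,
  to \<open>(0, v\<^sub>1)\<close>, on the incoming one. In null coordinates it is the graph \<open>v = \<gamma> u\<close> of an
  increasing function, and the region \<open>\<D>(0, v\<^sub>1)\<close> bounded by it and the two cones is the part
  of \<open>u\<^sub>0 \<le> u \<le> 0\<close>, \<open>v \<le> v\<^sub>1\<close> on or above this graph.\<close>

definition center_curve :: "(real \<Rightarrow> real) \<Rightarrow> real \<Rightarrow> real \<Rightarrow> bool" where
  "center_curve \<gamma> u0 v1 \<longleftrightarrow>
     continuous_on {u0..0} \<gamma> \<and> strict_mono_on {u0..0} \<gamma> \<and> \<gamma> u0 = 0 \<and> \<gamma> 0 = v1"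

definition center :: "(real \<Rightarrow> real) \<Rightarrow> real \<Rightarrow> (real \<times> real) set" where
  "center \<gamma> u0 = {(u, v). u0 \<le> u \<and> u \<le> 0 \<and> v = \<gamma> u}"

definition central_region :: "(real \<Rightarrow> real) \<Rightarrow> real \<Rightarrow> real \<Rightarrow> (real \<times> real) set" where
  "central_region \<gamma> u0 v1 = {(u, v). u0 \<le> u \<and> u \<le> 0 \<and> \<gamma> u \<le> v \<and> v \<le> v1}"

definition outgoing_cone :: "real \<Rightarrow> (real \<times> real) set" where
  "outgoing_cone u0 = {(u, v). u = u0 \<and> 0 \<le> v}"

definition incoming_cone :: "real \<Rightarrow> real \<Rightarrow> (real \<times> real) set" where
  "incoming_cone u0 v1 = {(u, v). v = v1 \<and> u0 \<le> u \<and> u \<le> 0}"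

definition spherical_solution_on ::
  "(real \<times> real) set \<Rightarrow> (real \<times> real) set \<Rightarrow> (real \<times> real \<Rightarrow> real) \<Rightarrow> (real \<times> real \<Rightarrow> real) \<Rightarrow>
   (real \<times> real \<Rightarrow> real) \<Rightarrow> bool"
where
  "spherical_solution_on K Z r \<Omega> \<phi> \<longleftrightarrow>
     smooth_up_to_boundary K r \<and> smooth_up_to_boundary K \<Omega> \<and> smooth_up_to_boundary K \<phi> \<and>
     (\<forall>p\<in>K. \<Omega> p > 0) \<and>
     (\<forall>p\<in>K. einstein_scalar_at r \<Omega> \<phi> p) \<and>
     (\<forall>p\<in>K \<inter> Z. r p = 0 \<and> hawking_mass r \<Omega> p = 0) \<and>
     (\<forall>p\<in>K - Z. r p > 0)"

end

theory Submission
  imports Defs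
begin

text \<open>Suppose that \<open>\<partial>\<^sub>v r\<close> never vanishes on the rectangle, so that it is positive. The
  Raychaudhuri equation together with \<open>m = \<phi> = 0\<close> on \<open>v = v\<^sub>1\<close> gives \<open>\<partial>\<^sub>u r < 0\<close> there, hence
  on the whole rectangle, and \<open>m \<ge> 0\<close> makes the width \<open>r\<^sub>2 - r\<^sub>1\<close> nonincreasing in \<open>u\<close>. Since
  \<open>\<partial>\<^sub>u\<phi> = 0\<close> on \<open>v = v\<^sub>1\<close>, the wave equation and Cauchy-Schwarz bound the loss of mass by
  \<open>- \<partial>\<^sub>u m\<^sub>2 \<le> - \<partial>\<^sub>u r\<^sub>2 m\<^sub>2 (1 / r\<^sub>1 - 1 / r\<^sub>2)\<close>. With \<open>c\<close> the initial width,
  \<open>r\<^sub>1 \<ge> r\<^sub>2 - c\<close>, so \<open>m\<^sub>2 r\<^sub>2 / (r\<^sub>2 - c)\<close> is nondecreasing in \<open>u\<close>. At \<open>u\<^sub>*\<close>, where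
  \<open>r\<^sub>2 = 3 c\<close>, this forces \<open>2 m\<^sub>2 > r\<^sub>2\<close>, which is impossible without a trapped surface.\<close>

section \<open>Calculus of partial derivatives of smooth functions\<close>

lemma smooth_du: "smooth_up_to_boundary K f \<Longrightarrow> smooth_up_to_boundary K (du f)"
  unfolding smooth_up_to_boundary_def by (meson Ck_on.simps(2))

lemma smooth_dv: "smooth_up_to_boundary K f \<Longrightarrow> smooth_up_to_boundary K (dv f)"
  unfolding smooth_up_to_boundary_def by (meson Ck_on.simps(2))

lemma smooth_subset: "smooth_up_to_boundary K f \<Longrightarrow> L \<subseteq> K \<Longrightarrow> smooth_up_to_boundary L f"
  unfolding smooth_up_to_boundary_def by (meson subset_trans)

lemma smooth_continuous_on: "smooth_up_to_boundary K f \<Longrightarrow> continuous_on K f"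
  unfolding smooth_up_to_boundary_def by (metis Ck_on.simps(1) continuous_on_subset)

lemma has_du_differentiable:
  assumes "f differentiable (at (u, v))"
  shows "((\<lambda>s. f (s, v)) has_real_derivative du f (u, v)) (at u)"
proof -
  have "(\<lambda>s. (s, v)) differentiable (at u)"
    unfolding differentiable_def
    by (rule exI, rule has_derivative_Pair[OF has_derivative_ident has_derivative_const])
  then have "(\<lambda>s. f (s, v)) differentiable (at u)"
    using differentiable_chain_at[of "\<lambda>s. (s, v)" u f] assms
    by (simp add: o_def)
  then show ?thesis
    by (simp add: du_def DERIV_deriv_iff_real_differentiable)
qed

lemma has_dv_differentiable:
  assumes "f differentiable (at (u, v))"
  shows "((\<lambda>s. f (u, s)) has_real_derivative dv f (u, v)) (at v)"
proof -
  have "(\<lambda>s. (u, s)) differentiable (at v)"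
    unfolding differentiable_def
    by (rule exI, rule has_derivative_Pair[OF has_derivative_const has_derivative_ident])
  then have "(\<lambda>s. f (u, s)) differentiable (at v)"
    using differentiable_chain_at[of "\<lambda>s. (u, s)" v f] assms
    by (simp add: o_def)
  then show ?thesis
    by (simp add: dv_def DERIV_deriv_iff_real_differentiable)
qed

lemma smooth_differentiable:
  assumes "smooth_up_to_boundary K f" "p \<in> K"
  shows "f differentiable (at p)"
  using assms unfolding smooth_up_to_boundary_def
  by (metis Ck_on.simps(2) differentiable_on_eq_differentiable_at subsetD)

lemma has_du:
  assumes "smooth_up_to_boundary K f" "(u, v) \<in> K"
  shows "((\<lambda>s. f (s, v)) has_real_derivative du f (u, v)) (at u)"
  using assms by (intro has_du_differentiable smooth_differentiable)

lemma has_dv: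
  assumes "smooth_up_to_boundary K f" "(u, v) \<in> K"
  shows "((\<lambda>s. f (u, s)) has_real_derivative dv f (u, v)) (at v)"
  using assms by (intro has_dv_differentiable smooth_differentiable)

text \<open>Applying the mean value theorem twice, in either order, to the double difference of
  \<open>f\<close> over a small square expresses it as \<open>h^2\<close> times each mixed
  derivative at some point of that square. Continuity of both mixed derivatives then excludes a gap
  between them at \<open>(u, v)\<close>.\<close>

lemma du_dv_eq_dv_du:
  assumes "smooth_up_to_boundary K f" "(u, v) \<in> K"
  shows "du (dv f) (u, v) = dv (du f) (u, v)"
proof -
  obtain U where U: "open U" "K \<subseteq> U" and Ck: "\<And>k. Ck_on k U f"
    using assms unfolding smooth_up_to_boundary_def by auto
  have sm: "smooth_up_to_boundary U f"
    using U Ck unfolding smooth_up_to_boundary_def by auto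
  have p: "(u, v) \<in> U" using U assms by auto
  have c1: "isCont (du (dv f)) (u, v)" and c2: "isCont (dv (du f)) (u, v)"
    using U p smooth_continuous_on[OF smooth_du[OF smooth_dv[OF sm]]]
      smooth_continuous_on[OF smooth_dv[OF smooth_du[OF sm]]]
    by (auto simp: continuous_on_eq_continuous_at)
  show ?thesis
  proof (rule ccontr)
    assume ne: "\<not> ?thesis"
    define e where "e = \<bar>du (dv f) (u, v) - dv (du f) (u, v)\<bar> / 2"
    have e: "e > 0" using ne by (simp add: e_def)
    obtain d1 where d1: "d1 > 0" "\<And>q. dist q (u, v) < d1 \<Longrightarrow> dist (du (dv f) q) (du (dv f) (u, v)) < e"
      using c1 e unfolding continuous_at_eps_delta by (metis dist_commute)
    obtain d2 where d2: "d2 > 0" "\<And>q. dist q (u, v) < d2 \<Longrightarrow> dist (dv (du f) q) (dv (du f) (u, v)) < e"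
      using c2 e unfolding continuous_at_eps_delta by (metis dist_commute)
    obtain d3 where d3: "d3 > 0" "ball (u, v) d3 \<subseteq> U"
      using U p by (meson open_contains_ball)
    \<comment> \<open>A point of the square of side \<open>h\<close> lies within
      \<open>2 * h\<close> of the corner; dividing by 3 keeps this strictly below all three
      radii.\<close>
    define h where "h = min d1 (min d2 d3) / 3"
    have h: "h > 0" using d1 d2 d3 by (simp add: h_def)
    have near: "dist (x, y) (u, v) < min d1 (min d2 d3)"
      if "u \<le> x" "x \<le> u + h" "v \<le> y" "y \<le> v + h" for x y
    proof -
      have "dist (x, y) (u, v) \<le> \<bar>x - u\<bar> + \<bar>y - v\<bar>"
        by (simp add: dist_Pair_Pair dist_real_def sqrt_sum_squares_le_sum_abs)
      also have "\<dots> \<le> 2 * h" using that by auto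
      finally show ?thesis using h unfolding h_def by linarith
    qed
    have inU: "(x, y) \<in> U" if "u \<le> x" "x \<le> u + h" "v \<le> y" "y \<le> v + h" for x y
      using near[OF that] d3 by (auto simp: dist_commute subset_iff)
    define D where "D = f (u + h, v + h) - f (u + h, v) - f (u, v + h) + f (u, v)"
    have "\<exists>x>u. x < u + h \<and> (f (u + h, v + h) - f (u + h, v)) - (f (u, v + h) - f (u, v))
        = (u + h - u) * (du f (x, v + h) - du f (x, v))"
      using h by (intro MVT2) (auto intro!: DERIV_diff has_du[OF sm] inU)
    then obtain x where x: "u < x" "x < u + h" "D = h * (du f (x, v + h) - du f (x, v))"
      by (auto simp: D_def)
    have "\<exists>y>v. y < v + h \<and> du f (x, v + h) - du f (x, v) = (v + h - v) * dv (du f) (x, y)"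
      using h x by (intro MVT2) (auto intro!: has_dv[OF smooth_du[OF sm]] inU)
    then obtain y where y: "v < y" "y < v + h" "D = h * (h * dv (du f) (x, y))"
      using x by auto
    have "\<exists>y>v. y < v + h \<and> (f (u + h, v + h) - f (u, v + h)) - (f (u + h, v) - f (u, v))
        = (v + h - v) * (dv f (u + h, y) - dv f (u, y))"
      using h by (intro MVT2) (auto intro!: DERIV_diff has_dv[OF sm] inU)
    then obtain y' where y': "v < y'" "y' < v + h" "D = h * (dv f (u + h, y') - dv f (u, y'))"
      by (auto simp: D_def)
    have "\<exists>x>u. x < u + h \<and> dv f (u + h, y') - dv f (u, y') = (u + h - u) * du (dv f) (x, y')"
      using h y' by (intro MVT2) (auto intro!: has_du[OF smooth_dv[OF sm]] inU)
    then obtain x' where x': "u < x'" "x' < u + h" "D = h * (h * du (dv f) (x', y'))"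
      using y' by auto
    have "dv (du f) (x, y) = du (dv f) (x', y')" using x' y h by simp
    moreover have "dist (dv (du f) (x, y)) (dv (du f) (u, v)) < e"
      using near[of x y] x y by (intro d2) auto
    moreover have "dist (du (dv f) (x', y')) (du (dv f) (u, v)) < e"
      using near[of x' y'] x' y' by (intro d1) auto
    ultimately show False unfolding e_def dist_real_def by (smt (verit) field_sum_of_halves)
  qed
qed

section \<open>Analytic and algebraic tools\<close>

text \<open>Cauchy-Schwarz in differential form, with no integrals: for each fixed \<open>t\<close>
  the form \<open>t^2 p + 2 t q + s\<close> starts at 0 and has nonnegative derivative, so at
  \<open>b\<close> it is nonnegative for all \<open>t\<close>, and its discriminant has the required
  sign.\<close>

lemma monotone_cauchy_schwarz:
  fixes p q s :: "real \<Rightarrow> real"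
  assumes "a \<le> b" and "p a = 0" "q a = 0" "s a = 0"
    and der: "\<And>x. a \<le> x \<Longrightarrow> x \<le> b \<Longrightarrow> (p has_real_derivative p' x) (at x)"
      "\<And>x. a \<le> x \<Longrightarrow> x \<le> b \<Longrightarrow> (q has_real_derivative q' x) (at x)"
      "\<And>x. a \<le> x \<Longrightarrow> x \<le> b \<Longrightarrow> (s has_real_derivative s' x) (at x)"
    and nonneg: "\<And>x. a \<le> x \<Longrightarrow> x \<le> b \<Longrightarrow> 0 \<le> p' x" "\<And>x. a \<le> x \<Longrightarrow> x \<le> b \<Longrightarrow> 0 \<le> s' x"
    and disc: "\<And>x. a \<le> x \<Longrightarrow> x \<le> b \<Longrightarrow> (q' x)\<^sup>2 \<le> p' x * s' x"
  shows "(q b)\<^sup>2 \<le> p b * s b"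
proof -
  have form: "0 \<le> t\<^sup>2 * p b + 2 * t * q b + s b" for t
  proof -
    have "t\<^sup>2 * p a + 2 * t * q a + s a \<le> t\<^sup>2 * p b + 2 * t * q b + s b"
    proof (rule DERIV_nonneg_imp_nondecreasing[OF \<open>a \<le> b\<close>], intro exI conjI)
      fix x assume x: "a \<le> x" "x \<le> b"
      show "((\<lambda>x. t\<^sup>2 * p x + 2 * t * q x + s x) has_real_derivative
          t\<^sup>2 * p' x + 2 * t * q' x + s' x) (at x)"
        using der[OF x] by (auto intro!: derivative_eq_intros)
      have "(2 * t * q' x)\<^sup>2 \<le> 4 * t\<^sup>2 * (p' x * s' x)"
        using mult_left_mono[OF disc[OF x], of "4 * t\<^sup>2"] by (simp add: power_mult_distrib)
      also have "\<dots> \<le> (t\<^sup>2 * p' x + s' x)\<^sup>2"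
        using zero_le_power2[of "t\<^sup>2 * p' x - s' x"] by (simp add: power2_eq_square algebra_simps)
      finally have "\<bar>2 * t * q' x\<bar> \<le> \<bar>t\<^sup>2 * p' x + s' x\<bar>"
        by (simp add: abs_le_square_iff)
      then show "0 \<le> t\<^sup>2 * p' x + 2 * t * q' x + s' x"
        using nonneg[OF x] by (smt (verit) mult_nonneg_nonneg zero_le_power2)
    qed
    then show ?thesis using assms by simp
  qed
  have "p a \<le> p b"
    using der(1) nonneg(1) by (intro DERIV_nonneg_imp_nondecreasing[OF \<open>a \<le> b\<close>]) blast
  then consider "p b = 0" "q b = 0" | "p b = 0" "q b \<noteq> 0" | "p b > 0" using assms by force
  then show ?thesis
  proof cases
    \<comment> \<open>With \<open>p b = 0\<close> the form is affine in \<open>t\<close>; this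
      \<open>t\<close> makes it equal to -1.\<close>
    case 2
    then show ?thesis using form[of "- (s b + 1) / (2 * q b)"] by (simp add: field_simps)
  next
    case 3
    \<comment> \<open>The form is evaluated at its minimizer \<open>t = - q b / p b\<close>.\<close>
    then have "0 \<le> p b * ((q b / p b)\<^sup>2 * p b - 2 * (q b / p b) * q b + s b)"
      using form[of "- q b / p b"] by simp
    also have "\<dots> = p b * s b - (q b)\<^sup>2"
      using 3 by (simp add: field_simps power2_eq_square)
    finally show ?thesis by simp
  qed simp
qed

text \<open>Since \<open>deriv\<close> is total, an equation for \<open>du\<close> or
  \<open>dv\<close> of a quotient describes a genuine derivative only once differentiability is
  known. This makes the Raychaudhuri equations usable.\<close>

lemma differentiable_divide_square:
  assumes "smooth_up_to_boundary K f" "smooth_up_to_boundary K g" "p \<in> K" "g p \<noteq> 0"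
  shows "(\<lambda>q. f q / (g q)\<^sup>2) differentiable (at p)"
  using assms by (intro differentiable_divide differentiable_power smooth_differentiable) auto

text \<open>At an endpoint of the segment \<open>f\<close> is known to vanish on one side only. The
  two-sided derivative restricts to a one-sided one, which is unique because
  \<open>a < b\<close>.\<close>

lemma du_eq_0:
  assumes "a < b" and "smooth_up_to_boundary K f" and "{a..b} \<times> {v} \<subseteq> K"
    and zero: "\<And>u. u \<in> {a..b} \<Longrightarrow> f (u, v) = 0" and u: "u \<in> {a..b}"
  shows "du f (u, v) = 0"
proof -
  have p: "(u, v) \<in> K" using assms(3) u by auto
  have "((\<lambda>s. f (s, v)) has_vector_derivative du f (u, v)) (at u within cbox a b)"
    using has_du[OF assms(2) p] has_vector_derivative_at_within
    by (auto simp: has_real_derivative_iff_has_vector_derivative)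
  moreover have "((\<lambda>s. f (s, v)) has_vector_derivative 0) (at u within cbox a b)"
    using zero u by (intro has_vector_derivative_transform[OF _ _ has_vector_derivative_const[of 0]]) auto
  ultimately show ?thesis
    using vector_derivative_unique_within_closed_interval[OF \<open>a < b\<close>, of u] u by auto
qed

text \<open>The algebra common to both derivatives of the mass, with \<open>w\<close> for
  \<open>\<Omega>^2\<close> and \<open>x\<close> for the mixed derivative of \<open>r\<close>. The
  equation for \<open>r\<close> cancels everything except the scalar field term; exchanging
  \<open>a\<close> and \<open>b\<close> exchanges the two null directions.\<close>

lemma mass_derivative_identity:
  fixes r a b x y w :: real
  assumes "w > 0" and "r * x + b * a = - w / 4"
  shows "b / 2 * (1 + 4 * a * (b / w)) +
      r / 2 * (4 * (x * (b / w) + a * (- 4 * pi * r / w * y\<^sup>2))) = - 8 * pi * r\<^sup>2 * a * y\<^sup>2 / w"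
proof -
  have x: "r * x = - w / 4 - b * a" using assms by simp
  have "b / 2 * (1 + 4 * a * (b / w)) +
      r / 2 * (4 * (x * (b / w) + a * (- 4 * pi * r / w * y\<^sup>2)))
    = b / 2 * (1 + 4 * a * (b / w)) + 2 * (r * x) * (b / w) - 8 * pi * r\<^sup>2 * a * y\<^sup>2 / w"
    by (simp add: field_simps power2_eq_square)
  also have "b / 2 * (1 + 4 * a * (b / w)) + 2 * (r * x) * (b / w) = 0"
    unfolding x using \<open>w > 0\<close> by (simp add: field_simps)
  finally show ?thesis by simp
qed

section \<open>Rectangles without trapped or marginally trapped spheres\<close>

text \<open>The right end \<open>b\<close> is left free so that rectangles stopping short of the
  central point \<open>(0, v1)\<close>, where \<open>r\<close> vanishes, are available before
  \<open>ustar < 0\<close> is known.\<close>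

locale untrapped_rectangle =
  fixes r \<Omega> \<phi> :: "real \<times> real \<Rightarrow> real" and a b v1 v2 :: real and R :: "(real \<times> real) set"
  assumes R_def: "R = {a..b} \<times> {v1..v2}"
    and ab: "a \<le> b" and v12: "v1 < v2"
    and smooth: "smooth_up_to_boundary R r" "smooth_up_to_boundary R \<Omega>" "smooth_up_to_boundary R \<phi>"
    and Omega_pos: "\<And>p. p \<in> R \<Longrightarrow> \<Omega> p > 0"
    and r_pos: "\<And>p. p \<in> R \<Longrightarrow> r p > 0"
    and einstein: "\<And>p. p \<in> R \<Longrightarrow> einstein_scalar_at r \<Omega> \<phi> p"
    and untrapped: "\<And>p. p \<in> R \<Longrightarrow> dv r p > 0"
    and du_r_v1: "\<And>u. u \<in> {a..b} \<Longrightarrow> du r (u, v1) < 0"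
    and mass_v1: "\<And>u. u \<in> {a..b} \<Longrightarrow> hawking_mass r \<Omega> (u, v1) = 0"
    and du_phi_v1: "\<And>u. u \<in> {a..b} \<Longrightarrow> du \<phi> (u, v1) = 0"
begin

abbreviation "m \<equiv> hawking_mass r \<Omega>"

lemmas smooth_first = smooth_du[OF smooth(1)] smooth_dv[OF smooth(1)]
  smooth_du[OF smooth(3)] smooth_dv[OF smooth(3)]

lemmas partials = has_du[OF smooth(1)] has_dv[OF smooth(1)]
  has_du[OF smooth_first(1)] has_dv[OF smooth_first(1)]
  has_du[OF smooth_first(2)] has_dv[OF smooth_first(2)]
  has_dv[OF smooth_first(3)]

lemma
  assumes "p \<in> R"
  shows r_uv: "r p * dv (du r) p = - (\<Omega> p)\<^sup>2 / 4 - dv r p * du r p"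
    and raychaudhuri_u: "du (\<lambda>q. du r q / (\<Omega> q)\<^sup>2) p = - 4 * pi * r p / (\<Omega> p)\<^sup>2 * (du \<phi> p)\<^sup>2"
    and raychaudhuri_v: "dv (\<lambda>q. dv r q / (\<Omega> q)\<^sup>2) p = - 4 * pi * r p / (\<Omega> p)\<^sup>2 * (dv \<phi> p)\<^sup>2"
    and wave: "r p * dv (du \<phi>) p = - du r p * dv \<phi> p - dv r p * du \<phi> p"
proof -
  obtain u v where p: "p = (u, v)" by (cases p)
  show "r p * dv (du r) p = - (\<Omega> p)\<^sup>2 / 4 - dv r p * du r p"
    "du (\<lambda>q. du r q / (\<Omega> q)\<^sup>2) p = - 4 * pi * r p / (\<Omega> p)\<^sup>2 * (du \<phi> p)\<^sup>2"
    "dv (\<lambda>q. dv r q / (\<Omega> q)\<^sup>2) p = - 4 * pi * r p / (\<Omega> p)\<^sup>2 * (dv \<phi> p)\<^sup>2"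
    using einstein[OF assms] by (auto simp: einstein_scalar_at_def)
  show "r p * dv (du \<phi>) p = - du r p * dv \<phi> p - dv r p * du \<phi> p"
    using einstein[OF assms] du_dv_eq_dv_du[OF smooth(3)] assms
    by (auto simp: einstein_scalar_at_def p)
qed

section \<open>Raychaudhuri equations and derivatives of the Hawking mass\<close>

lemma du_r_Omega:
  assumes "(u, v) \<in> R"
  shows "((\<lambda>s. du r (s, v) / (\<Omega> (s, v))\<^sup>2) has_real_derivative
    - 4 * pi * r (u, v) / (\<Omega> (u, v))\<^sup>2 * (du \<phi> (u, v))\<^sup>2) (at u)"
  using has_du_differentiable[OF differentiable_divide_square[OF smooth_du[OF smooth(1)] smooth(2) assms]]
    Omega_pos[OF assms] by (simp add: raychaudhuri_u[OF assms])

lemma dv_r_Omega: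
  assumes "(u, v) \<in> R"
  shows "((\<lambda>s. dv r (u, s) / (\<Omega> (u, s))\<^sup>2) has_real_derivative
    - 4 * pi * r (u, v) / (\<Omega> (u, v))\<^sup>2 * (dv \<phi> (u, v))\<^sup>2) (at v)"
  using has_dv_differentiable[OF differentiable_divide_square[OF smooth_dv[OF smooth(1)] smooth(2) assms]]
    Omega_pos[OF assms] by (simp add: raychaudhuri_v[OF assms])

text \<open>Regrouping the mass so that \<open>dv r / \<Omega>^2\<close> is one factor lets the
  Raychaudhuri equation supply its derivative, and no derivative of \<open>\<Omega>\<close>
  appears.\<close>

lemma has_dv_mass:
  assumes "(u, v) \<in> R"
  shows "((\<lambda>s. m (u, s)) has_real_derivative
    - 8 * pi * (r (u, v))\<^sup>2 * du r (u, v) * (dv \<phi> (u, v))\<^sup>2 / (\<Omega> (u, v))\<^sup>2) (at v)"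
proof -
  let ?p = "(u, v)"
  have "m = (\<lambda>p. r p / 2 * (1 + 4 * du r p * (dv r p / (\<Omega> p)\<^sup>2)))"
    by (simp add: hawking_mass_def fun_eq_iff)
  moreover have "((\<lambda>s. r (u, s) / 2 * (1 + 4 * du r (u, s) * (dv r (u, s) / (\<Omega> (u, s))\<^sup>2)))
     has_real_derivative dv r ?p / 2 * (1 + 4 * du r ?p * (dv r ?p / (\<Omega> ?p)\<^sup>2)) +
      r ?p / 2 * (4 * (dv (du r) ?p * (dv r ?p / (\<Omega> ?p)\<^sup>2) +
        du r ?p * (- 4 * pi * r ?p / (\<Omega> ?p)\<^sup>2 * (dv \<phi> ?p)\<^sup>2)))) (at v)"
    by (rule dv_r_Omega DERIV_cdivide derivative_eq_intros partials assms refl)+ (simp add: algebra_simps)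
  ultimately show ?thesis
    using mass_derivative_identity[of "(\<Omega> ?p)\<^sup>2" "r ?p" "dv (du r) ?p" "dv r ?p" "du r ?p" "dv \<phi> ?p"]
      r_uv[OF assms] Omega_pos[OF assms] by simp
qed

lemma has_du_mass:
  assumes "(u, v) \<in> R"
  shows "((\<lambda>s. m (s, v)) has_real_derivative
    - 8 * pi * (r (u, v))\<^sup>2 * dv r (u, v) * (du \<phi> (u, v))\<^sup>2 / (\<Omega> (u, v))\<^sup>2) (at u)"
proof -
  let ?p = "(u, v)"
  have "m = (\<lambda>p. r p / 2 * (1 + 4 * dv r p * (du r p / (\<Omega> p)\<^sup>2)))"
    by (simp add: hawking_mass_def fun_eq_iff)
  moreover have "((\<lambda>s. r (s, v) / 2 * (1 + 4 * dv r (s, v) * (du r (s, v) / (\<Omega> (s, v))\<^sup>2)))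
     has_real_derivative du r ?p / 2 * (1 + 4 * dv r ?p * (du r ?p / (\<Omega> ?p)\<^sup>2)) +
      r ?p / 2 * (4 * (du (dv r) ?p * (du r ?p / (\<Omega> ?p)\<^sup>2) +
        dv r ?p * (- 4 * pi * r ?p / (\<Omega> ?p)\<^sup>2 * (du \<phi> ?p)\<^sup>2)))) (at u)"
    by (rule du_r_Omega DERIV_cdivide derivative_eq_intros partials assms refl)+ (simp add: algebra_simps)
  ultimately show ?thesis
    using mass_derivative_identity[of "(\<Omega> ?p)\<^sup>2" "r ?p" "du (dv r) ?p" "du r ?p" "dv r ?p" "du \<phi> ?p"]
      r_uv[OF assms] du_dv_eq_dv_du[OF smooth(1) assms] Omega_pos[OF assms]
    by (simp add: mult.commute)
qed

section \<open>Signs and monotonicity\<close>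

text \<open>The equation for \<open>r\<close> says that \<open>r * du r\<close> has
  \<open>v\<close>-derivative \<open>- \<Omega>^2 / 4\<close>, so its negative sign on
  \<open>v = v1\<close> persists.\<close>

lemma du_r_neg:
  assumes "(u, v) \<in> R"
  shows "du r (u, v) < 0"
proof -
  have uv: "u \<in> {a..b}" "v1 \<le> v" "v \<le> v2" using assms by (auto simp: R_def)
  have "r (u, v) * du r (u, v) \<le> r (u, v1) * du r (u, v1)"
  proof (rule DERIV_nonpos_imp_nonincreasing[OF \<open>v1 \<le> v\<close>], intro exI conjI)
    fix x assume "v1 \<le> x" "x \<le> v"
    then have x: "(u, x) \<in> R" using uv by (auto simp: R_def)
    show "((\<lambda>x. r (u, x) * du r (u, x)) has_real_derivative - (\<Omega> (u, x))\<^sup>2 / 4) (at x)"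
      by (rule derivative_eq_intros partials x refl)+ (use r_uv[OF x] in \<open>simp add: mult.commute\<close>)
  qed simp
  also have "\<dots> < 0"
    using uv v12 du_r_v1 r_pos[of "(u, v1)"] by (auto simp: R_def mult_pos_neg)
  finally show ?thesis
    using r_pos[OF assms] by (simp add: mult_less_0_iff)
qed

text \<open>By definition \<open>1 - 2 m / r\<close> equals
  \<open>- 4 du r dv r / \<Omega>^2\<close>, and the two null derivatives of \<open>r\<close> have
  opposite signs.\<close>

lemma mass_less:
  assumes "p \<in> R"
  shows "2 * m p < r p"
proof -
  have "du r p * dv r p / (\<Omega> p)\<^sup>2 < 0"
    using du_r_neg[of "fst p" "snd p"] untrapped[OF assms] Omega_pos[OF assms] assms
    by (simp add: divide_neg_pos mult_neg_pos)
  then have "4 * r p * (du r p * dv r p / (\<Omega> p)\<^sup>2) < 0"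
    using r_pos[OF assms] by (intro mult_pos_neg) auto
  moreover have "2 * m p = r p + 4 * r p * (du r p * dv r p / (\<Omega> p)\<^sup>2)"
    by (simp add: hawking_mass_def algebra_simps)
  ultimately show ?thesis by linarith
qed

lemma dv_mass_nonneg:
  assumes "(u, v) \<in> R"
  shows "0 \<le> - 8 * pi * (r (u, v))\<^sup>2 * du r (u, v) * (dv \<phi> (u, v))\<^sup>2 / (\<Omega> (u, v))\<^sup>2"
proof -
  have "0 \<le> - 8 * pi * (r (u, v))\<^sup>2 * du r (u, v)"
    using du_r_neg[OF assms] by (intro mult_nonpos_nonpos) auto
  from divide_nonneg_nonneg[OF mult_nonneg_nonneg[OF this zero_le_power2] zero_le_power2]
  show ?thesis .
qed

lemma mass_nonneg:
  assumes "(u, v) \<in> R"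
  shows "0 \<le> m (u, v)"
proof -
  have uv: "u \<in> {a..b}" "v1 \<le> v" "v \<le> v2" using assms by (auto simp: R_def)
  have "m (u, v1) \<le> m (u, v)"
  proof (rule DERIV_nonneg_imp_nondecreasing[OF \<open>v1 \<le> v\<close>], intro exI conjI)
    fix x assume "v1 \<le> x" "x \<le> v"
    then have x: "(u, x) \<in> R" using uv by (auto simp: R_def)
    show "((\<lambda>s. m (u, s)) has_real_derivative
      - 8 * pi * (r (u, x))\<^sup>2 * du r (u, x) * (dv \<phi> (u, x))\<^sup>2 / (\<Omega> (u, x))\<^sup>2) (at x)"
      by (rule has_dv_mass[OF x])
    show "0 \<le> - 8 * pi * (r (u, x))\<^sup>2 * du r (u, x) * (dv \<phi> (u, x))\<^sup>2 / (\<Omega> (u, x))\<^sup>2"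
      by (rule dv_mass_nonneg[OF x])
  qed
  then show ?thesis using mass_v1[OF uv(1)] by simp
qed

text \<open>In terms of the mass, the equation for \<open>r\<close> reads
  \<open>r * dv (du r) = - \<Omega>^2 m / (2 r)\<close>, and \<open>m\<close> is
  nonnegative.\<close>

lemma dv_du_r_nonpos:
  assumes "(u, v) \<in> R"
  shows "dv (du r) (u, v) \<le> 0"
proof -
  let ?p = "(u, v)"
  have W: "(\<Omega> ?p)\<^sup>2 > 0" using Omega_pos[OF assms] by simp
  have "r ?p * ((\<Omega> ?p)\<^sup>2 + 4 * du r ?p * dv r ?p) = 2 * m ?p * (\<Omega> ?p)\<^sup>2"
    using W by (simp add: hawking_mass_def field_simps)
  then have "0 \<le> r ?p * ((\<Omega> ?p)\<^sup>2 + 4 * du r ?p * dv r ?p)"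
    using mass_nonneg[OF assms] by simp
  then have "0 \<le> (\<Omega> ?p)\<^sup>2 + 4 * du r ?p * dv r ?p"
    using r_pos[OF assms] by (simp add: zero_le_mult_iff)
  then have "r ?p * dv (du r) ?p \<le> 0"
    using r_uv[OF assms] by (simp add: algebra_simps)
  then show ?thesis using r_pos[OF assms] by (simp add: mult_le_0_iff)
qed

lemma du_r_antimono:
  assumes "u \<in> {a..b}" "v1 \<le> v" "v \<le> w" "w \<le> v2"
  shows "du r (u, w) \<le> du r (u, v)"
proof (rule DERIV_nonpos_imp_nonincreasing[OF \<open>v \<le> w\<close>], intro exI conjI)
  fix x assume "v \<le> x" "x \<le> w"
  then have x: "(u, x) \<in> R" using assms by (auto simp: R_def)
  show "((\<lambda>x. du r (u, x)) has_real_derivative dv (du r) (u, x)) (at x)"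
    by (rule partials x)+
  show "dv (du r) (u, x) \<le> 0" by (rule dv_du_r_nonpos[OF x])
qed

lemma dv_r_Omega_antimono:
  assumes "u \<in> {a..b}" "v1 \<le> v" "v \<le> w" "w \<le> v2"
  shows "dv r (u, w) / (\<Omega> (u, w))\<^sup>2 \<le> dv r (u, v) / (\<Omega> (u, v))\<^sup>2"
proof (rule DERIV_nonpos_imp_nonincreasing[OF \<open>v \<le> w\<close>], intro exI conjI)
  fix x assume "v \<le> x" "x \<le> w"
  then have x: "(u, x) \<in> R" using assms by (auto simp: R_def)
  show "((\<lambda>x. dv r (u, x) / (\<Omega> (u, x))\<^sup>2) has_real_derivative
     - 4 * pi * r (u, x) / (\<Omega> (u, x))\<^sup>2 * (dv \<phi> (u, x))\<^sup>2) (at x)"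
    by (rule dv_r_Omega[OF x])
  show "- 4 * pi * r (u, x) / (\<Omega> (u, x))\<^sup>2 * (dv \<phi> (u, x))\<^sup>2 \<le> 0"
    using r_pos[OF x] by simp
qed

lemma r_strict_mono:
  assumes "u \<in> {a..b}"
  shows "r (u, v1) < r (u, v2)"
proof (rule DERIV_pos_imp_increasing[OF v12], intro exI conjI)
  fix x assume "v1 \<le> x" "x \<le> v2"
  then have x: "(u, x) \<in> R" using assms by (auto simp: R_def)
  show "((\<lambda>x. r (u, x)) has_real_derivative dv r (u, x)) (at x)"
    by (rule partials x)+
  show "0 < dv r (u, x)" by (rule untrapped[OF x])
qed

lemma width_antimono:
  assumes "a \<le> u" "u \<le> b"
  shows "r (u, v2) - r (u, v1) \<le> r (a, v2) - r (a, v1)"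
proof (rule DERIV_nonpos_imp_nonincreasing[OF \<open>a \<le> u\<close>], intro exI conjI)
  fix x assume "a \<le> x" "x \<le> u"
  then have x: "(x, v1) \<in> R" "(x, v2) \<in> R" using assms v12 by (auto simp: R_def)
  show "((\<lambda>x. r (x, v2) - r (x, v1)) has_real_derivative du r (x, v2) - du r (x, v1)) (at x)"
    by (rule derivative_intros partials x)+
  show "du r (x, v2) - du r (x, v1) \<le> 0"
    using du_r_antimono[of x v1 v2] v12 x by (auto simp: R_def)
qed

text \<open>Along a fixed \<open>u\<close>, \<open>r \<partial>\<^sub>u\<phi>\<close> vanishes at \<open>v\<^sub>1\<close> and has \<open>v\<close>-derivative
  \<open>- \<partial>\<^sub>u r \<partial>\<^sub>v\<phi>\<close>, so Cauchy-Schwarz bounds it by the mass.\<close>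

lemma flux_bound:
  assumes "u \<in> {a..b}"
  shows "8 * pi * (r (u, v2))\<^sup>2 * dv r (u, v2) * (du \<phi> (u, v2))\<^sup>2 / (\<Omega> (u, v2))\<^sup>2
    \<le> - du r (u, v2) * m (u, v2) * (1 / r (u, v1) - 1 / r (u, v2))"
proof -
  define k where "k = dv r (u, v2) / (\<Omega> (u, v2))\<^sup>2"
  \<comment> \<open>\<open>N\<close> is the least constant with
    \<open>- du r <= 8 pi N dv r / \<Omega>^2\<close> along the whole segment, with equality at
    \<open>v2\<close>. This inequality yields the discriminant condition for the comparison function
    \<open>s\<close>.\<close>
  define N where "N = - du r (u, v2) / (8 * pi * k)"
  have in_R: "(u, x) \<in> R" if "v1 \<le> x" "x \<le> v2" for x using that assms by (auto simp: R_def)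
  have p2: "(u, v2) \<in> R" using in_R v12 by simp
  have k: "k > 0" using untrapped[OF p2] Omega_pos[OF p2] by (simp add: k_def)
  have N: "N > 0" using k du_r_neg[OF p2] by (auto simp: N_def divide_neg_pos)
  have "(r (u, v2) * du \<phi> (u, v2))\<^sup>2 \<le> m (u, v2) * (N * (1 / r (u, v1) - 1 / r (u, v2)))"
  proof (rule monotone_cauchy_schwarz[where a = v1 and p = "\<lambda>x. m (u, x)" and
        q = "\<lambda>x. r (u, x) * du \<phi> (u, x)" and s = "\<lambda>x. N * (1 / r (u, v1) - 1 / r (u, x))"])
    fix x assume "v1 \<le> x" "x \<le> v2"
    note x = in_R[OF this]
    have r: "r (u, x) \<noteq> 0" "r (u, x) > 0" and W: "(\<Omega> (u, x))\<^sup>2 > 0"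
      using r_pos[OF x] Omega_pos[OF x] by auto
    show "((\<lambda>s. m (u, s)) has_real_derivative
      - 8 * pi * (r (u, x))\<^sup>2 * du r (u, x) * (dv \<phi> (u, x))\<^sup>2 / (\<Omega> (u, x))\<^sup>2) (at x)"
      by (rule has_dv_mass[OF x])
    show "((\<lambda>x. r (u, x) * du \<phi> (u, x)) has_real_derivative - du r (u, x) * dv \<phi> (u, x)) (at x)"
      by (rule derivative_eq_intros partials x refl)+ (use wave[OF x] in \<open>simp add: mult.commute\<close>)
    show "((\<lambda>x. N * (1 / r (u, v1) - 1 / r (u, x))) has_real_derivative
        N * dv r (u, x) / (r (u, x))\<^sup>2) (at x)"
      by (rule derivative_eq_intros partials x refl r)+ (use r in \<open>simp add: field_simps power2_eq_square\<close>)
    show "0 \<le> - 8 * pi * (r (u, x))\<^sup>2 * du r (u, x) * (dv \<phi> (u, x))\<^sup>2 / (\<Omega> (u, x))\<^sup>2"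
      by (rule dv_mass_nonneg[OF x])
    show "0 \<le> N * dv r (u, x) / (r (u, x))\<^sup>2"
      using N untrapped[OF x] by simp
    \<comment> \<open>As \<open>v\<close> increases, \<open>- du r\<close> does not decrease and
      \<open>dv r / \<Omega>^2\<close> does not increase; each factor is compared with its value at
      \<open>v2\<close>.\<close>
    have "(- du r (u, x)) * k \<le> (- du r (u, v2)) * (dv r (u, x) / (\<Omega> (u, x))\<^sup>2)"
      using du_r_antimono[of u x v2] dv_r_Omega_antimono[of u x v2] du_r_neg[OF x] du_r_neg[OF p2]
        k assms \<open>v1 \<le> x\<close> \<open>x \<le> v2\<close>
      by (intro mult_mono) (auto simp: k_def)
    then have "- du r (u, x) \<le> (- du r (u, v2)) * (dv r (u, x) / (\<Omega> (u, x))\<^sup>2) / k"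
      using k by (subst pos_le_divide_eq) simp_all
    then have "- du r (u, x) \<le> 8 * pi * N * (dv r (u, x) / (\<Omega> (u, x))\<^sup>2)"
      using k by (simp add: N_def mult.commute)
    then have "(dv \<phi> (u, x))\<^sup>2 * (- du r (u, x)) * (- du r (u, x))
        \<le> (dv \<phi> (u, x))\<^sup>2 * (- du r (u, x)) * (8 * pi * N * (dv r (u, x) / (\<Omega> (u, x))\<^sup>2))"
      using du_r_neg[OF x] by (intro mult_left_mono) (auto simp: mult_nonneg_nonpos)
    also have "\<dots> = - 8 * pi * (r (u, x))\<^sup>2 * du r (u, x) * (dv \<phi> (u, x))\<^sup>2 / (\<Omega> (u, x))\<^sup>2
        * (N * dv r (u, x) / (r (u, x))\<^sup>2)"
      using r W by (simp add: field_simps)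
    finally show "(- du r (u, x) * dv \<phi> (u, x))\<^sup>2
      \<le> - 8 * pi * (r (u, x))\<^sup>2 * du r (u, x) * (dv \<phi> (u, x))\<^sup>2 / (\<Omega> (u, x))\<^sup>2
        * (N * dv r (u, x) / (r (u, x))\<^sup>2)"
      by (simp add: power2_eq_square mult_ac)
  qed (use v12 assms mass_v1 du_phi_v1 in auto)
  \<comment> \<open>The factor \<open>8 * pi * k\<close> turns the square into the mass flux through
    \<open>v = v2\<close> and cancels the denominator of \<open>N\<close>.\<close>
  then have "8 * pi * k * (r (u, v2) * du \<phi> (u, v2))\<^sup>2
      \<le> 8 * pi * k * (m (u, v2) * (N * (1 / r (u, v1) - 1 / r (u, v2))))"
    using k by (intro mult_left_mono) auto
  also have "\<dots> = - du r (u, v2) * m (u, v2) * (1 / r (u, v1) - 1 / r (u, v2))"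
    using k by (simp add: N_def)
  finally show ?thesis by (simp add: k_def power_mult_distrib mult_ac)
qed

section \<open>Evolution of the mass along \<open>v = v2\<close>\<close>

lemma r_v2_antimono:
  assumes "a \<le> u" "u \<le> b"
  shows "r (b, v2) \<le> r (u, v2)"
proof (rule DERIV_nonpos_imp_nonincreasing[OF \<open>u \<le> b\<close>], intro exI conjI)
  fix x assume "u \<le> x" "x \<le> b"
  then have x: "(x, v2) \<in> R" using assms v12 by (auto simp: R_def)
  show "((\<lambda>x. r (x, v2)) has_real_derivative du r (x, v2)) (at x)"
    by (rule partials x)+
  show "du r (x, v2) \<le> 0" using du_r_neg[OF x] by simp
qed

text \<open>Formally, the flux bound says that the logarithmic derivative of \<open>m\<close> is at
  least that of \<open>(r - c) / r\<close>. The quotient form integrates this without dividing by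
  \<open>m\<close>, which may vanish.\<close>

lemma mass_quotient_mono:
  defines "c \<equiv> r (a, v2) - r (a, v1)"
  assumes c: "c < r (b, v2)"
  shows "m (a, v2) * r (a, v2) / (r (a, v2) - c) \<le> m (b, v2) * r (b, v2) / (r (b, v2) - c)"
proof (rule DERIV_nonneg_imp_nondecreasing[OF ab], intro exI conjI)
  fix u assume u: "a \<le> u" "u \<le> b"
  let ?p = "(u, v2)"
  let ?m' = "- 8 * pi * (r ?p)\<^sup>2 * dv r ?p * (du \<phi> ?p)\<^sup>2 / (\<Omega> ?p)\<^sup>2"
  have p: "?p \<in> R" "(u, v1) \<in> R" using u v12 by (auto simp: R_def)
  have pos: "r ?p - c > 0" using c r_v2_antimono[OF u] by simp
  have r: "r ?p > 0" "r (u, v1) > 0" using r_pos p by auto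
  show "((\<lambda>u. m (u, v2) * r (u, v2) / (r (u, v2) - c)) has_real_derivative
      (?m' * r ?p * (r ?p - c) - c * m ?p * du r ?p) / (r ?p - c)\<^sup>2) (at u)"
    by (rule derivative_eq_intros has_du_mass partials p refl)+
      (use pos in \<open>auto simp: field_simps power2_eq_square\<close>)
  \<comment> \<open>The width never exceeds its initial value \<open>c\<close>, so
    \<open>r - c\<close> bounds the inner radius from below and the estimate involves
    \<open>r\<close> on \<open>v = v2\<close> only.\<close>
  have "1 / r (u, v1) \<le> 1 / (r ?p - c)"
    using width_antimono[OF u] pos r by (intro divide_left_mono) (auto simp: c_def)
  then have "- du r ?p * m ?p * (1 / r (u, v1) - 1 / r ?p)
      \<le> - du r ?p * m ?p * (1 / (r ?p - c) - 1 / r ?p)"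
    using du_r_neg[OF p(1)] mass_nonneg[OF p(1)]
    by (intro mult_left_mono) (auto simp: mult_nonpos_nonneg)
  then have "- ?m' \<le> - du r ?p * m ?p * (1 / (r ?p - c) - 1 / r ?p)"
    using flux_bound[of u] u by simp
  also have "\<dots> = - du r ?p * m ?p * c / (r ?p * (r ?p - c))"
    using pos r by (simp add: field_simps)
  finally have "- ?m' * (r ?p * (r ?p - c)) \<le> - du r ?p * m ?p * c"
    using pos r by (subst (asm) pos_le_divide_eq) simp_all
  then show "0 \<le> (?m' * r ?p * (r ?p - c) - c * m ?p * du r ?p) / (r ?p - c)\<^sup>2"
    by (intro divide_nonneg_nonneg) (simp_all add: algebra_simps)
qed

text \<open>Origin of the constant 9/2: at \<open>b\<close> the factor \<open>r / (r - c)\<close> is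
  \<open>3/2\<close>, and \<open>2 m < r = 3 c\<close> there. At \<open>a\<close> the denominator
  \<open>r - c\<close> is the inner radius.\<close>

lemma initial_mass_bound:
  defines "c \<equiv> r (a, v2) - r (a, v1)"
  assumes rb: "r (b, v2) = 3 * c"
  shows "2 * m (a, v2) * r (a, v2) / r (a, v1) < 9 / 2 * c"
proof -
  have "c > 0" using r_strict_mono[of a] ab by (simp add: c_def)
  then have "m (a, v2) * r (a, v2) / r (a, v1) \<le> m (b, v2) * r (b, v2) / (r (b, v2) - c)"
    using mass_quotient_mono rb by (simp add: c_def)
  also have "\<dots> = 3 / 2 * m (b, v2)" using rb \<open>c > 0\<close> by (simp add: field_simps)
  finally show ?thesis using mass_less[of "(b, v2)"] rb ab v12 by (simp add: R_def)
qed

end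

section \<open>Data on the incoming cone and the contradiction\<close>

theorem theorem1p2:
  fixes r \<Omega> \<phi> :: "real \<times> real \<Rightarrow> real" and \<gamma> :: "real \<Rightarrow> real"
    and u0 v1 v2 ustar \<delta>0 \<eta>0 :: real and K :: "(real \<times> real) set"
  assumes "u0 < 0" and "0 < v1" and "v1 < v2"
    and "center_curve \<gamma> u0 v1"
    and "ustar \<in> {u0..0}"
    and "K = central_region \<gamma> u0 v1 \<union> {u0..ustar} \<times> {v1..v2}"
    and "spherical_solution_on K (center \<gamma> u0) r \<Omega> \<phi>"
    and "\<forall>p \<in> (outgoing_cone u0 \<union> incoming_cone u0 v1) \<inter> K. (\<Omega> p)\<^sup>2 = 1"
    and "dv r (u0, 0) = - du r (u0, 0)"
    and "\<delta>0 = r (u0, v2) / r (u0, v1) - 1"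
    and "\<eta>0 = 2 * (hawking_mass r \<Omega> (u0, v2) - hawking_mass r \<Omega> (u0, v1)) / r (u0, v2)"
    and "r (ustar, v2) = 3 * \<delta>0 / (1 + \<delta>0) * r (u0, v2)"
    and "\<forall>u \<in> {u0..0}. hawking_mass r \<Omega> (u, v1) = 0"
    and "\<forall>u \<in> {u0..0}. \<phi> (u, v1) = 0"
    and "\<eta>0 > 9 / 2 * \<delta>0"
  shows "\<exists>p \<in> {u0..ustar} \<times> {v1..v2}. MOTS r p \<or> trapped_surface r p"
proof (rule ccontr)
  assume "\<not> ?thesis"
  then have no_mots: "dv r p \<noteq> 0" if "p \<in> {u0..ustar} \<times> {v1..v2}" for p
    using that by (auto simp: MOTS_def)
  have smooth: "smooth_up_to_boundary K r" "smooth_up_to_boundary K \<Omega>" "smooth_up_to_boundary K \<phi>"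
    and Omega_pos: "\<And>p. p \<in> K \<Longrightarrow> \<Omega> p > 0"
    and einstein: "\<And>p. p \<in> K \<Longrightarrow> einstein_scalar_at r \<Omega> \<phi> p"
    and r_center: "\<And>p. p \<in> K \<inter> center \<gamma> u0 \<Longrightarrow> r p = 0"
    and r_pos_off_center: "\<And>p. p \<in> K - center \<gamma> u0 \<Longrightarrow> r p > 0"
    using assms(7) unfolding spherical_solution_on_def by auto
  have \<gamma>: "\<gamma> u < v1" if "u0 \<le> u" "u < 0" for u
    using assms(4) that by (auto simp: center_curve_def strict_mono_on_def)
  have \<gamma>0: "\<gamma> 0 = v1" using assms(4) by (simp add: center_curve_def)
  have cone: "(u, v1) \<in> K" if "u \<in> {u0..0}" for u
    using that \<gamma>[of u] \<gamma>0 assms(6) by (cases "u = 0") (auto simp: central_region_def)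
  have Omega_cone: "(\<Omega> (u, v1))\<^sup>2 = 1" if "u \<in> {u0..0}" for u
    using assms(8) cone[OF that] that by (auto simp: incoming_cone_def)
  have r_pos: "r (u, v) > 0" if "(u, v) \<in> K" "u < 0" "v1 \<le> v" for u v
    using r_pos_off_center[of "(u, v)"] \<gamma>[of u] that by (force simp: center_def)
  have r_end: "r (0, v1) = 0"
    using r_center[of "(0, v1)"] cone[of 0] \<gamma>0 assms(1) by (auto simp: center_def)
  have du_phi: "du \<phi> (u, v1) = 0" if "u \<in> {u0..0}" for u
    using assms(14) that cone by (intro du_eq_0[OF assms(1) smooth(3)]) auto

  \<comment> \<open>With no scalar flux along the incoming cone, Raychaudhuri makes this quotient
    constant; the normalization of \<open>\<Omega>\<close> then makes \<open>du r\<close> itself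
    constant.\<close>
  have "\<exists>c. \<forall>u\<in>{u0..0}. du r (u, v1) / (\<Omega> (u, v1))\<^sup>2 = c"
  proof (rule has_field_derivative_zero_constant)
    fix u assume u: "u \<in> {u0..0}"
    have "((\<lambda>u. du r (u, v1) / (\<Omega> (u, v1))\<^sup>2) has_real_derivative
        du (\<lambda>q. du r q / (\<Omega> q)\<^sup>2) (u, v1)) (at u)"
      using cone[OF u] Omega_pos[OF cone[OF u]]
      by (intro has_du_differentiable differentiable_divide_square[OF smooth_du[OF smooth(1)] smooth(2)]) auto
    moreover have "du (\<lambda>q. du r q / (\<Omega> q)\<^sup>2) (u, v1) = 0"
      using einstein[OF cone[OF u]] du_phi[OF u] by (simp add: einstein_scalar_at_def)
    ultimately show "((\<lambda>u. du r (u, v1) / (\<Omega> (u, v1))\<^sup>2) has_real_derivative 0)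
        (at u within {u0..0})"
      by (simp add: has_field_derivative_at_within)
  qed simp
  then obtain c where c: "\<And>u. u \<in> {u0..0} \<Longrightarrow> du r (u, v1) = c"
    using Omega_cone by auto
  \<comment> \<open>The radius falls from a positive value to 0 at the tip of the cone, which fixes
    the sign of \<open>c\<close>.\<close>
  have "\<exists>u>u0. u < 0 \<and> r (0, v1) - r (u0, v1) = (0 - u0) * du r (u, v1)"
    using assms(1) cone by (intro MVT2 has_du[OF smooth(1)]) auto
  then have "0 - r (u0, v1) = (0 - u0) * c" using r_end c by auto
  then have "u0 * c > 0" using r_pos[of u0 v1] cone[of u0] assms(1) by auto
  then have "c < 0" using assms(1) by (simp add: zero_less_mult_iff)
  then have du_r_cone: "du r (u, v1) < 0" if "u \<in> {u0..0}" for u using c[OF that] by simp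

  have dv_r_cone: "dv r (u0, v1) > 0"
  proof -
    have u0: "u0 \<in> {u0..0}" using assms(1) by simp
    have "hawking_mass r \<Omega> (u0, v1) = 0" using assms(13) u0 by blast
    \<comment> \<open>Zero mass at positive radius makes the second factor of the Hawking mass
      vanish.\<close>
    then have "1 + 4 * du r (u0, v1) * dv r (u0, v1) = 0"
      using r_pos[of u0 v1] cone[OF u0] Omega_cone[OF u0] assms(1)
      by (simp add: hawking_mass_def)
    then have "du r (u0, v1) * dv r (u0, v1) < 0" by simp
    then show ?thesis using du_r_cone[OF u0] by (simp add: mult_less_0_iff)
  qed

  have rectangle: "untrapped_rectangle r \<Omega> \<phi> u0 b v1 v2 ({u0..b} \<times> {v1..v2})"
    if b: "u0 \<le> b" "b \<le> ustar" "b < 0" for b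
  proof
    let ?R = "{u0..b} \<times> {v1..v2}"
    have sub: "?R \<subseteq> K" using assms(6) b by auto
    show "smooth_up_to_boundary ?R r" "smooth_up_to_boundary ?R \<Omega>" "smooth_up_to_boundary ?R \<phi>"
      using smooth smooth_subset sub by blast+
    show "\<Omega> p > 0" "einstein_scalar_at r \<Omega> \<phi> p" if "p \<in> ?R" for p
      using that sub Omega_pos einstein by blast+
    show "r p > 0" if "p \<in> ?R" for p
      using that sub r_pos[of "fst p" "snd p"] b by auto
    \<comment> \<open>Starting from \<open>dv r > 0\<close> at \<open>(u0, v1)\<close>, a
      nonpositive value elsewhere would force a zero, that is a MOTS, on the connected
      rectangle.\<close>
    have conn: "connected (dv r ` ?R)"
      by (intro connected_continuous_image convex_connected convex_Times
          continuous_on_subset[OF smooth_continuous_on[OF smooth_dv[OF smooth(1)]] sub]) auto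
    show "dv r p > 0" if p: "p \<in> ?R" for p
    proof (rule ccontr)
      assume "\<not> dv r p > 0"
      then have "0 \<in> {dv r p..dv r (u0, v1)}" using dv_r_cone by simp
      moreover have "{dv r p..dv r (u0, v1)} \<subseteq> dv r ` ?R"
        using p b assms(3) by (intro connected_contains_Icc[OF conn]) auto
      ultimately obtain q where "q \<in> ?R" "dv r q = 0" by force
      then show False using no_mots[of q] b by auto
    qed
  qed (use b assms(3,5,13) du_r_cone du_phi in auto)

  define w where "w = r (u0, v2) - r (u0, v1)"
  have u0: "u0 \<le> u0" "u0 \<le> ustar" "u0 < 0" using assms by auto
  have r1: "r (u0, v1) > 0" using r_pos[of u0 v1] cone[of u0] assms(1) by auto
  have r12: "r (u0, v1) < r (u0, v2)"
    using untrapped_rectangle.r_strict_mono[OF rectangle[OF u0]] by simp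
  have \<delta>0: "\<delta>0 = w / r (u0, v1)" using assms(10) r1 by (simp add: w_def field_simps)
  have "0 \<le> \<delta>0" using \<delta>0 r1 r12 by (simp add: w_def)
  have r_ustar: "r (ustar, v2) = 3 * w"
  proof -
    have "1 + \<delta>0 = r (u0, v2) / r (u0, v1)" using assms(10) by simp
    then show ?thesis using assms(12) \<delta>0 r1 r12 by simp
  qed
  \<comment> \<open>If \<open>ustar\<close> were 0, the width bound on the rectangles with
    \<open>b < 0\<close> would pass to the limit, whereas the width at \<open>u = 0\<close> is
    \<open>3 * w - 0\<close>, larger than \<open>w\<close>.\<close>
  have ustar: "ustar < 0"
  proof (rule ccontr)
    assume "\<not> ustar < 0"
    then have [simp]: "ustar = 0" using assms(5) by simp
    have "isCont (\<lambda>u. r (u, v2) - r (u, v1)) 0"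
      using assms(1,3,6) by (intro continuous_diff DERIV_isCont[OF has_du[OF smooth(1)]]) auto
    then have tend: "((\<lambda>u. r (u, v2) - r (u, v1)) \<longlongrightarrow> r (0, v2) - r (0, v1)) (at_left 0)"
      unfolding isCont_def by (rule tendsto_within_subset) simp
    have "\<forall>\<^sub>F u in at_left 0. u0 < u" "\<forall>\<^sub>F u in at_left 0. u < (0::real)"
      using assms(1) by (auto simp: eventually_at_left_field intro: exI[of _ u0])
    then have "\<forall>\<^sub>F u in at_left 0. r (u, v2) - r (u, v1) \<le> w"
    proof eventually_elim
      case (elim u)
      then show ?case
        using untrapped_rectangle.width_antimono[OF rectangle[of u], of u] by (simp add: w_def)
    qed
    then have "r (0, v2) - r (0, v1) \<le> w"
      by (intro tendsto_upperbound[OF tend]) auto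
    then show False using r_ustar r_end r12 by (simp add: w_def)
  qed
  interpret untrapped_rectangle r \<Omega> \<phi> u0 ustar v1 v2 "{u0..ustar} \<times> {v1..v2}"
    using rectangle u0 ustar by simp
  have "2 * m (u0, v2) * r (u0, v2) / r (u0, v1) < 9 / 2 * w"
    using initial_mass_bound r_ustar by (simp add: w_def)
  moreover have "2 * m (u0, v2) = \<eta>0 * r (u0, v2)"
    using assms(11,13) u0 r1 r12 by simp
  ultimately have upper: "\<eta>0 * (r (u0, v2))\<^sup>2 < 9 / 2 * w * r (u0, v1)"
    using r1 by (simp add: field_simps power2_eq_square)
  \<comment> \<open>Rewriting \<open>w\<close> as \<open>\<delta>0 * r (u0, v1)\<close> brings in
    the hypothesis on \<open>\<eta>0\<close>; enlarging the radius to \<open>r (u0, v2)\<close> is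
    allowed because \<open>\<eta>0\<close> is positive.\<close>
  have "9 / 2 * w * r (u0, v1) = 9 / 2 * \<delta>0 * (r (u0, v1))\<^sup>2"
    using \<delta>0 r1 by (simp add: power2_eq_square)
  also have "\<dots> < \<eta>0 * (r (u0, v1))\<^sup>2"
    using assms(15) r1 by (intro mult_strict_right_mono) auto
  also have "\<dots> \<le> \<eta>0 * (r (u0, v2))\<^sup>2"
    using r1 r12 \<open>0 \<le> \<delta>0\<close> assms(15) by (intro mult_left_mono power_mono) auto
  finally show False using upper by simp
qed

end
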